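(* Let $T\in\mathbb Z_{\ge0}$, $N\in\mathbb Z_{\ge1}$, and let $G=(V,E)$ be a finite directed acyclic planar graph with $V=V_0\sqcup\dots\sqcup V_T$ and $E=E_{0\to1}\sqcup\dots\sqcup E_{T-1\to T}$, where $E_{n\to n+1}$ contains only edges directed from a vertex of $V_n$ to a vertex of $V_{n+1}$. Let $w_e\in\mathbb R$ be edge weights, $\psi_i:V_0\to\mathbb R$ and $\varphi_i:V_T\to\mathbb R$, $1\le i\le N$, functions. For $m\le n$, $x\in V_m$, $y\in V_n$ let $\mathcal W_{m,n}(x,y)=\sum_{\pi:x\to y}w(\pi)$ ($\mathcal W_{n,n}=I$), and for $x\in V_n$ put $$\varphi_j^{(n)}(x)=\sum_{y\in V_T}\mathcal W_{n,T}(x,y)\varphi_j(y),\qquad \psi_j^{(n)}(x)=\sum_{u\in V_0}\psi_j(u)\mathcal W_{0,n}(u,x).$$ Assume the biorthogonality condition $\sum_{x\in V_0}\psi_i(x)\varphi_j^{(0)}(x)=\mathbf 1_{i=j}$ for $1\le i,j\le N$. Let $\nu(\Pi)=Wt(\Pi)/Z$ be the (signed, total mass one) measure on $\mathcal{N.I.}(N)$ defined in the context, where $Z\ne0$. For $x_1,x_2\in V_n$ let $K_n(x_1,x_2)=\sum_{i=1}^N\varphi_i^{(n)}(x_1)\psi_i^{(n)}(x_2)$, and for $x\in V_m$, $y\in V_n$ define $$K^{\rm ext}(m,x;n,y)=\begin{cases}\mathcal W_{m,n}K_n(x,y)& m\ge n,\\ -\mathcal W_{m,n}(I-K_n)(x,y)&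 m<n,\end{cases}$$ where, for $m>n$, $\mathcal W_{m,n}$ denotes the right inverse of $\mathcal W_{n,m}$ on $\mathrm{span}\{\varphi_i^{(n)}\}_{i=1}^N$ given by $\varphi_i^{(n)}\mapsto\varphi_i^{(m)}$, so that $\mathcal W_{m,n}K_n(x,y)=\sum_{i=1}^N\varphi_i^{(m)}(x)\psi_i^{(n)}(y)$. Then for any functions $q_n:V_n\to\mathbb R$, $0\le n\le T-1$, $$\sum_{\Pi=\{\pi_1,\dots,\pi_N\}\in\mathcal{N.I.}(N)}\ \prod_{i=1}^N\prod_{n=0}^{T-1}\big(1-q_n(\pi_i(n))\big)\,\nu(\Pi)=\det\big(I-QK^{\rm ext}\big)_{L^2(V)},$$ where $Q$ is the diagonal matrix $Qf(n,x)=q_n(x)f(n,x)$ for $x\in V_n$, $0\le n\le T-1$, and $Qf(T,x)=0$ for $x\in V_T$.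
   Context: A path $\pi$ from $x\in V_m$ to $y\in V_n$ ($m\le n$) is a sequence of consecutive directed edges $x=x_m\to x_{m+1}\to\dots\to x_n=y$ with $x_k\in V_k$; $w(\pi)$ is the product of the weights of its edges and $\pi(k)=x_k$. Two paths intersect if they share a vertex. $\mathcal{N.I.}(N)$ is the set of (unordered) collections $\Pi=\{\pi_1,\dots,\pi_N\}$ of $N$ paths from $V_0$ to $V_T$ no two of which intersect. For such $\Pi$, $$Wt(\Pi)=\det[\psi_i(\pi_j(0))]_{i,j=1}^N\Big(\prod_{i=1}^Nw(\pi_i)\Big)\det[\varphi_i(\pi_j(T))]_{i,j=1}^N$$ (independent of the labelling) and $Z=\sum_{\Pi\in\mathcal{N.I.}(N)}Wt(\Pi)$. A vertex $x\in V_n$ is also written $(n,x)$; matrices on $L^2(V)$ (counting measure) have entries $M(m,x;n,y)$, and the determinant is an ordinary one. *)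

theory Defs
  imports "HOL-Analysis.Analysis"
begin

text \<open>
  The vertex set is a finite type, so that matrices on \<open>L\<^sup>2(V)\<close> are matrices in the sense of
  HOL-Analysis; \<open>V n\<close> is the \<open>n\<close>-th layer, used for \<open>n \<le> T\<close> only.
  The indices \<open>1, \<dots>, N\<close> of the functions \<open>\<psi>\<^sub>i, \<phi>\<^sub>i\<close> are the elements of a finite type with
  \<open>N\<close> elements. Functions on one layer are total functions whose values elsewhere are never used.
\<close>

text \<open>A plane drawing: distinct points for the vertices, and for every edge a simple curve between
  its endpoints; a curve meets the vertices only in its own endpoints, and two curves meet only in
  vertices.\<close>

definition planar_digraph :: "('v \<times> 'v) set \<Rightarrow> bool" where
  "planar_digraph E \<longleftrightarrow>
     (\<exists>(p :: 'v \<Rightarrow> complex) (\<gamma> :: 'v \<times> 'v \<Rightarrow> real \<Rightarrow> complex).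
        inj p \<and>
        (\<forall>(u, v) \<in> E. simple_path (\<gamma> (u, v)) \<and>
           pathstart (\<gamma> (u, v)) = p u \<and> pathfinish (\<gamma> (u, v)) = p v \<and>
           path_image (\<gamma> (u, v)) \<inter> range p = {p u, p v}) \<and>
        (\<forall>e \<in> E. \<forall>e' \<in> E. e \<noteq> e' \<longrightarrow> path_image (\<gamma> e) \<inter> path_image (\<gamma> e') \<subseteq> range p))"

text \<open>A path from layer \<open>m\<close> to layer \<open>n\<close> is the function \<open>k \<mapsto> \<pi>(k)\<close> on \<open>{m..n}\<close>, extensional so
  that equality of functions is equality of paths.\<close>

definition paths :: "(nat \<Rightarrow> 'v set) \<Rightarrow> ('v \<times> 'v) set \<Rightarrow> nat \<Rightarrow> nat \<Rightarrow> (nat \<Rightarrow> 'v) set" where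
  "paths V E m n = {\<pi> \<in> Pi\<^sub>E {m..n} V. \<forall>k\<in>{m..<n}. (\<pi> k, \<pi> (Suc k)) \<in> E}"

definition path_weight :: "('v \<times> 'v \<Rightarrow> real) \<Rightarrow> nat \<Rightarrow> nat \<Rightarrow> (nat \<Rightarrow> 'v) \<Rightarrow> real" where
  "path_weight w m n \<pi> = (\<Prod>k\<in>{m..<n}. w (\<pi> k, \<pi> (Suc k)))"

definition non_intersecting ::
    "(nat \<Rightarrow> 'v set) \<Rightarrow> ('v \<times> 'v) set \<Rightarrow> nat \<Rightarrow> nat \<Rightarrow> (nat \<Rightarrow> 'v) set set" where
  "non_intersecting V E T N =
     {\<P>. \<P> \<subseteq> paths V E 0 T \<and> card \<P> = N \<and>
         pairwise (\<lambda>\<pi> \<pi>'. disjnt (\<pi> ` {0..T}) (\<pi>' ` {0..T})) \<P>}"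

text \<open>The choice of labelling \<open>\<pi>\<close> is immaterial: a permutation changes both determinants
  by the same sign.\<close>

definition Wt ::
    "('v \<times> 'v \<Rightarrow> real) \<Rightarrow> nat \<Rightarrow> ('n::finite \<Rightarrow> 'v \<Rightarrow> real) \<Rightarrow> ('n \<Rightarrow> 'v \<Rightarrow> real) \<Rightarrow>
     (nat \<Rightarrow> 'v) set \<Rightarrow> real" where
  "Wt w T \<psi> \<phi> \<P> =
     (let \<pi> = (SOME \<pi>. bij_betw \<pi> (UNIV :: 'n set) \<P>) in
        det ((\<chi> i j. \<psi> i (\<pi> j 0)) :: real^'n^'n) *
        (\<Prod>i\<in>UNIV. path_weight w 0 T (\<pi> i)) *
        det ((\<chi> i j. \<phi> i (\<pi> j T)) :: real^'n^'n))"

definition Z_total ::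
    "(nat \<Rightarrow> 'v set) \<Rightarrow> ('v \<times> 'v) set \<Rightarrow> ('v \<times> 'v \<Rightarrow> real) \<Rightarrow> nat \<Rightarrow>
     ('n::finite \<Rightarrow> 'v \<Rightarrow> real) \<Rightarrow> ('n \<Rightarrow> 'v \<Rightarrow> real) \<Rightarrow> real" where
  "Z_total V E w T \<psi> \<phi> = (\<Sum>\<P>\<in>non_intersecting V E T CARD('n). Wt w T \<psi> \<phi> \<P>)"

definition \<nu> ::
    "(nat \<Rightarrow> 'v set) \<Rightarrow> ('v \<times> 'v) set \<Rightarrow> ('v \<times> 'v \<Rightarrow> real) \<Rightarrow> nat \<Rightarrow>
     ('n::finite \<Rightarrow> 'v \<Rightarrow> real) \<Rightarrow> ('n \<Rightarrow> 'v \<Rightarrow> real) \<Rightarrow> (nat \<Rightarrow> 'v) set \<Rightarrow> real" where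
  "\<nu> V E w T \<psi> \<phi> \<P> = Wt w T \<psi> \<phi> \<P> / Z_total V E w T \<psi> \<phi>"

text \<open>For \<open>m = n\<close> the only paths are single vertices, with weight \<open>1\<close>, so \<open>\<W> V E w n n\<close> is the
  identity on layer \<open>n\<close>.\<close>

definition \<W> ::
    "(nat \<Rightarrow> 'v set) \<Rightarrow> ('v \<times> 'v) set \<Rightarrow> ('v \<times> 'v \<Rightarrow> real) \<Rightarrow> nat \<Rightarrow> nat \<Rightarrow> 'v \<Rightarrow> 'v \<Rightarrow> real"
  where
  "\<W> V E w m n x y = (\<Sum>\<pi> \<in> {\<pi> \<in> paths V E m n. \<pi> m = x \<and> \<pi> n = y}. path_weight w m n \<pi>)"

definition \<phi>_layer ::
    "(nat \<Rightarrow> 'v set) \<Rightarrow> ('v \<times> 'v) set \<Rightarrow> ('v \<times> 'v \<Rightarrow> real) \<Rightarrow> nat \<Rightarrow>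
     ('n \<Rightarrow> 'v \<Rightarrow> real) \<Rightarrow> nat \<Rightarrow> 'n \<Rightarrow> 'v \<Rightarrow> real" where
  "\<phi>_layer V E w T \<phi> n j x = (\<Sum>y\<in>V T. \<W> V E w n T x y * \<phi> j y)"

definition \<psi>_layer ::
    "(nat \<Rightarrow> 'v set) \<Rightarrow> ('v \<times> 'v) set \<Rightarrow> ('v \<times> 'v \<Rightarrow> real) \<Rightarrow>
     ('n \<Rightarrow> 'v \<Rightarrow> real) \<Rightarrow> nat \<Rightarrow> 'n \<Rightarrow> 'v \<Rightarrow> real" where
  "\<psi>_layer V E w \<psi> n j x = (\<Sum>u\<in>V 0. \<psi> j u * \<W> V E w 0 n u x)"

definition K_layer ::
    "(nat \<Rightarrow> 'v set) \<Rightarrow> ('v \<times> 'v) set \<Rightarrow> ('v \<times> 'v \<Rightarrow> real) \<Rightarrow> nat \<Rightarrow>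
     ('n::finite \<Rightarrow> 'v \<Rightarrow> real) \<Rightarrow> ('n \<Rightarrow> 'v \<Rightarrow> real) \<Rightarrow> nat \<Rightarrow> 'v \<Rightarrow> 'v \<Rightarrow> real" where
  "K_layer V E w T \<psi> \<phi> n x\<^sub>1 x\<^sub>2 =
     (\<Sum>i\<in>UNIV. \<phi>_layer V E w T \<phi> n i x\<^sub>1 * \<psi>_layer V E w \<psi> n i x\<^sub>2)"

text \<open>The operator \<open>\<W>\<^sub>m\<^sub>,\<^sub>n\<close> applied to a function \<open>f\<close> on layer \<open>n\<close>. For \<open>m > n\<close> it is the linear map
  on the span of the functions \<open>\<phi>\<^sub>i\<^sup>(\<^sup>n\<^sup>)\<close> sending \<open>\<phi>\<^sub>i\<^sup>(\<^sup>n\<^sup>)\<close> to \<open>\<phi>\<^sub>i\<^sup>(\<^sup>m\<^sup>)\<close>; the coefficients \<open>c\<close> are unique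
  because biorthogonality makes these functions linearly independent. Outside the span the value is
  arbitrary.\<close>

definition \<W>_op ::
    "(nat \<Rightarrow> 'v set) \<Rightarrow> ('v \<times> 'v) set \<Rightarrow> ('v \<times> 'v \<Rightarrow> real) \<Rightarrow> nat \<Rightarrow>
     ('n::finite \<Rightarrow> 'v \<Rightarrow> real) \<Rightarrow> nat \<Rightarrow> nat \<Rightarrow> ('v \<Rightarrow> real) \<Rightarrow> 'v \<Rightarrow> real" where
  "\<W>_op V E w T \<phi> m n f x =
     (if m \<le> n then (\<Sum>y\<in>V n. \<W> V E w m n x y * f y)
      else (let c = (SOME c :: 'n \<Rightarrow> real.
                       \<forall>z\<in>V n. f z = (\<Sum>i\<in>UNIV. c i * \<phi>_layer V E w T \<phi> n i z))
            in (\<Sum>i\<in>UNIV. c i * \<phi>_layer V E w T \<phi> m i x)))"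

definition K_ext ::
    "(nat \<Rightarrow> 'v set) \<Rightarrow> ('v \<times> 'v) set \<Rightarrow> ('v \<times> 'v \<Rightarrow> real) \<Rightarrow> nat \<Rightarrow>
     ('n::finite \<Rightarrow> 'v \<Rightarrow> real) \<Rightarrow> ('n \<Rightarrow> 'v \<Rightarrow> real) \<Rightarrow> nat \<times> 'v \<Rightarrow> nat \<times> 'v \<Rightarrow> real" where
  "K_ext V E w T \<psi> \<phi> = (\<lambda>(m, x) (n, y).
     if m \<ge> n then \<W>_op V E w T \<phi> m n (\<lambda>z. K_layer V E w T \<psi> \<phi> n z y) x
     else - \<W>_op V E w T \<phi> m n (\<lambda>z. of_bool (z = y) - K_layer V E w T \<psi> \<phi> n z y) x)"

text \<open>Writing a vertex \<open>x\<close> as the pair \<open>(n, x)\<close> with \<open>x \<in> V n\<close>.\<close>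

definition layer_of :: "(nat \<Rightarrow> 'v set) \<Rightarrow> nat \<Rightarrow> 'v \<Rightarrow> nat" where
  "layer_of V T x = (THE n. n \<le> T \<and> x \<in> V n)"

definition K_ext_matrix ::
    "(nat \<Rightarrow> 'v set) \<Rightarrow> ('v \<times> 'v) set \<Rightarrow> ('v \<times> 'v \<Rightarrow> real) \<Rightarrow> nat \<Rightarrow>
     ('n::finite \<Rightarrow> 'v \<Rightarrow> real) \<Rightarrow> ('n \<Rightarrow> 'v \<Rightarrow> real) \<Rightarrow> real^'v^'v::finite" where
  "K_ext_matrix V E w T \<psi> \<phi> =
     (\<chi> x y. K_ext V E w T \<psi> \<phi> (layer_of V T x, x) (layer_of V T y, y))"

definition Q_matrix ::
    "(nat \<Rightarrow> 'v set) \<Rightarrow> nat \<Rightarrow> (nat \<Rightarrow> 'v \<Rightarrow> real) \<Rightarrow> real^'v^'v::finite" where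
  "Q_matrix V T q =
     (\<chi> x y. if x = y \<and> layer_of V T x < T then q (layer_of V T x) x else 0)"

end

theory Submission
  imports Defs
begin

text \<open>
  Let \<open>U\<close> be the strictly upper block triangular matrix of the \<open>\<W>\<^sub>m\<^sub>,\<^sub>n\<close>, \<open>m < n\<close>, so that
  \<open>K\<^sup>e\<^sup>x\<^sup>t = \<Phi> \<Psi> - U\<close> where \<open>\<Phi>\<close> and \<open>\<Psi>\<close> collect the \<open>\<phi>\<^sub>i\<^sup>(\<^sup>n\<^sup>)\<close> and the \<open>\<psi>\<^sub>i\<^sup>(\<^sup>n\<^sup>)\<close>. Since
  \<open>I + Q U\<close> is unipotent, \<open>det (I - Q K\<^sup>e\<^sup>x\<^sup>t) = det (I - \<Psi> X)\<close> with \<open>X = (I + Q U)\<^sup>-\<^sup>1 Q \<Phi>\<close>, and this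
  \<open>N \<times> N\<close> determinant turns out to be the determinant of the pairings of the \<open>\<psi>\<^sub>i\<close> with the
  \<open>\<phi>\<^sub>j\<^sup>(\<^sup>0\<^sup>)\<close> formed with the edge weights \<open>(1 - q) w\<close>. That determinant is the partition function for
  these weights: propagating \<open>det [\<psi>\<^sub>i\<^sup>(\<^sup>n\<^sup>)(y\<^sub>j)]\<close> one layer at a time by multilinearity, only injective
  tuples of vertices contribute, and for paths on disjoint layers injectivity on every layer is
  non-intersection.
\<close>

section \<open>Determinants\<close>

text \<open>Multilinearity in the columns: column \<open>j\<close> is a linear combination of the
  vectors \<open>(f i x)\<close> over \<open>i\<close>, and one \<open>x j\<close> is chosen per
  column. This is Cauchy-Binet before repeated columns are discarded.\<close>

lemma det_sum_columns:
  fixes f :: "'n::finite \<Rightarrow> 'v \<Rightarrow> 'a::comm_ring_1"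
  assumes S: "finite S"
  shows "det ((\<chi> i j. \<Sum>x\<in>S. f i x * b x j) :: 'a^'n^'n) =
     (\<Sum>x | \<forall>j. x j \<in> S. det ((\<chi> i j. f i (x j)) :: 'a^'n^'n) * (\<Prod>j\<in>UNIV. b (x j) j))"
proof -
  \<comment> \<open>\<open>det_def\<close> runs over rows; transposing puts the permutation on the
    row index, so that each fixed column contributes one factor to which the product of sums
    applies.\<close>
  have det_columns: "det ((\<chi> i j. g i j) :: 'a^'n^'n) =
      (\<Sum>p | p permutes UNIV. of_int (sign p) * (\<Prod>j\<in>UNIV. g (p j) j))" for g
    by (subst det_transpose [symmetric]) (simp add: transpose_def det_def)
  have PiE_UNIV: "PiE UNIV (\<lambda>_. S) = {x :: 'n \<Rightarrow> 'v. \<forall>j. x j \<in> S}"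
    by (auto simp: PiE_def)
  show ?thesis
    by (simp add: det_columns prod_sum_PiE [OF finite] S PiE_UNIV sum_distrib_left sum_distrib_right
        prod.distrib mult.assoc sum.swap [of _ _ "{p. p permutes UNIV}"])
qed

text \<open>A nonzero Leibniz term comes only from a permutation fixing every index outside
  \<open>range e\<close>. Such permutations are the transports of permutations of \<open>'n\<close>
  along \<open>e\<close>, with the same sign, and the fixed indices contribute diagonal entries
  \<open>1\<close>. It serves to evaluate block triangular determinants.\<close>

lemma det_eq_det_submatrix:
  fixes M :: "'a::comm_ring_1^'m^'m" and e :: "'n::finite \<Rightarrow> 'm::finite"
  assumes e: "inj e"
    and diag: "\<And>x. x \<notin> range e \<Longrightarrow> M $ x $ x = 1"
    and fixed: "\<And>p x. p permutes UNIV \<Longrightarrow> (\<And>y. M $ y $ p y \<noteq> 0) \<Longrightarrow> x \<notin> range e \<Longrightarrow> p x = x"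
  shows "det M = det ((\<chi> i j. M $ e i $ e j) :: 'a^'n^'n)"
proof -
  let ?h = "map_permutation UNIV e"
  have be: "bij_betw e UNIV (range e)"
    using e by (simp add: bij_betw_def)
  have inv_h: "?h (map_permutation (range e) (inv e) p) = p" if "p permutes range e" for p
    using map_permutation_compose_inv [OF bij_betw_inv_into [OF be] that, of e]
    by (auto simp: f_inv_into_f)
  have "det M = (\<Sum>p | p permutes range e. of_int (sign p) * (\<Prod>x\<in>UNIV. M $ x $ p x))"
    unfolding det_def
  proof (rule sum.mono_neutral_right)
    show "{p. p permutes range e} \<subseteq> {p. p permutes UNIV}"
      by (auto intro: permutes_subset)
    show "\<forall>p\<in>{p. p permutes UNIV} - {p. p permutes range e}.
        of_int (sign p) * (\<Prod>x\<in>UNIV. M $ x $ p x) = 0"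
    proof
      fix p assume p: "p \<in> {p. p permutes UNIV} - {p. p permutes range e}"
      then have "\<exists>x. M $ x $ p x = 0"
        using fixed permutes_superset[of p UNIV "range e"] by blast
      then show "of_int (sign p) * (\<Prod>x\<in>UNIV. M $ x $ p x) = 0"
        by (metis finite iso_tuple_UNIV_I mult_zero_right prod_zero)
    qed
  qed simp
  also have "\<dots> = (\<Sum>p | p permutes UNIV. of_int (sign (?h p)) * (\<Prod>x\<in>UNIV. M $ x $ ?h p x))"
    by (rule sum.reindex_bij_witness [of _ ?h "map_permutation (range e) (inv e)"])
      (use e be in \<open>auto simp: map_permutation_compose_inv [OF be] inv_h
        intro: map_permutation_permutes bij_betw_inv_into\<close>)
  also have "\<dots> = (\<Sum>p | p permutes UNIV. of_int (sign p) * (\<Prod>i\<in>UNIV. M $ e i $ e (p i)))"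
  proof (rule sum.cong [OF refl])
    fix p :: "'n \<Rightarrow> 'n" assume "p \<in> {p. p permutes UNIV}"
    then have p: "p permutes UNIV" by simp
    have hp: "?h p permutes range e"
      by (rule map_permutation_permutes [OF be p])
    have "(\<Prod>x\<in>UNIV. M $ x $ ?h p x) = (\<Prod>x\<in>range e. M $ x $ ?h p x)"
      by (rule prod.mono_neutral_right) (auto simp: diag permutes_not_in [OF hp])
    also have "\<dots> = (\<Prod>i\<in>UNIV. M $ e i $ e (p i))"
      by (simp add: prod.reindex e map_permutation_apply)
    finally show "of_int (sign (?h p)) * (\<Prod>x\<in>UNIV. M $ x $ ?h p x) =
        of_int (sign p) * (\<Prod>i\<in>UNIV. M $ e i $ e (p i))"
      using sign_map_permutation[OF e p] by simp
  qed
  finally show ?thesis by (simp add: det_def)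
qed

text \<open>The Weinstein-Aronszajn identity, by factoring the block matrix
  \<open>[1, A; B, 1]\<close> in two ways: \<open>[1, A; 0, 1] [1 - A B, 0; B, 1]\<close> and
  \<open>[1, 0; B, 1 - B A] [1, A; 0, 1]\<close>. The sum type \<open>'m + 'n\<close> indexes the
  blocks.\<close>

lemma det_one_minus_mult_commute:
  fixes A :: "'a::field^'n^'m" and B :: "'a^'m^'n"
  shows "det (mat 1 - A ** B) = det (mat 1 - B ** A)"
proof -
  define blocks :: "'a^'m^'m \<Rightarrow> 'a^'n^'m \<Rightarrow> 'a^'m^'n \<Rightarrow> 'a^'n^'n \<Rightarrow> 'a^('m+'n)^('m+'n)"
    where "blocks P X Y S = (\<chi> i j. case i of
        Inl i \<Rightarrow> (case j of Inl j \<Rightarrow> P $ i $ j | Inr j \<Rightarrow> X $ i $ j)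
      | Inr i \<Rightarrow> (case j of Inl j \<Rightarrow> Y $ i $ j | Inr j \<Rightarrow> S $ i $ j))" for P X Y S
  have blocks_mult: "blocks P X Y S ** blocks P' X' Y' S' =
      blocks (P ** P' + X ** Y') (P ** X' + X ** S') (Y ** P' + S ** Y') (Y ** X' + S ** S')"
    for P X Y S P' X' Y' S'
    by (auto simp: blocks_def matrix_matrix_mult_def vec_eq_iff sum.Plus
        UNIV_Plus_UNIV [symmetric] simp del: UNIV_Plus_UNIV split: sum.split)
  have det_P: "det (blocks P 0 Y (mat 1)) = det P" for P Y
  proof -
    have "det (blocks P 0 Y (mat 1)) = det (\<chi> i j. blocks P 0 Y (mat 1) $ Inl i $ Inl j)"
    proof (rule det_eq_det_submatrix)
      fix p :: "'m + 'n \<Rightarrow> 'm + 'n" and x :: "'m + 'n"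
      assume p: "p permutes UNIV" and nz: "\<And>y. blocks P 0 Y (mat 1) $ y $ p y \<noteq> 0"
        and x: "x \<notin> range Inl"
      \<comment> \<open>The zero block makes \<open>p\<close> map the left summand into itself,
        hence onto it by finiteness. So \<open>p x\<close> stays in the right summand, where the
        identity block forces \<open>p x = x\<close>.\<close>
      have "p (Inl i) \<in> range Inl" for i
        using nz[of "Inl i"] by (auto simp: blocks_def split: sum.splits)
      then have "p ` range Inl \<subseteq> range Inl" by auto
      then have "p ` range Inl = range Inl"
        by (intro endo_inj_surj) (auto intro: inj_on_subset [OF permutes_inj [OF p]])
      then have "p x \<notin> range Inl"
        using x permutes_inj [OF p] by (metis image_iff injD)
      then show "p x = x"
        using nz[of x] x by (auto simp: blocks_def mat_def split: sum.splits if_splits)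
    qed (auto simp: blocks_def mat_def split: sum.splits)
    then show ?thesis
      by (simp add: blocks_def)
  qed
  have det_S: "det (blocks (mat 1) 0 Y S) = det S" for Y S
  proof -
    have "det (blocks (mat 1) 0 Y S) = det (\<chi> i j. blocks (mat 1) 0 Y S $ Inr i $ Inr j)"
    proof (rule det_eq_det_submatrix)
      fix p :: "'m + 'n \<Rightarrow> 'm + 'n" and x :: "'m + 'n"
      assume p: "p permutes UNIV" and nz: "\<And>y. blocks (mat 1) 0 Y S $ y $ p y \<noteq> 0"
        and x: "x \<notin> range Inr"
      from x obtain i where "x = Inl i" by (cases x) auto
      then show "p x = x"
        using nz[of x] by (auto simp: blocks_def mat_def split: sum.splits if_splits)
    qed (auto simp: blocks_def mat_def split: sum.splits)
    then show ?thesis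
      by (simp add: blocks_def)
  qed
  have one: "blocks (mat 1) 0 0 (mat 1) = mat 1"
    by (auto simp: blocks_def mat_def vec_eq_iff split: sum.split)
  \<comment> \<open>The determinant of this common factor is not computed; invertibility makes it
    nonzero, which is enough to cancel it.\<close>
  have "blocks (mat 1) A 0 (mat 1) ** blocks (mat 1) (- A) 0 (mat 1) = mat 1"
    by (simp add: blocks_mult one)
  then have nz: "det (blocks (mat 1) A 0 (mat 1)) \<noteq> 0"
    by (metis det_I det_mul mult_zero_left zero_neq_one)
  have "blocks (mat 1) A 0 (mat 1) ** blocks (mat 1 - A ** B) 0 B (mat 1) =
      blocks (mat 1) 0 B (mat 1 - B ** A) ** blocks (mat 1) A 0 (mat 1)"
    by (simp add: blocks_mult)
  then have "det (blocks (mat 1) A 0 (mat 1)) * det (mat 1 - A ** B) =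
      det (mat 1 - B ** A) * det (blocks (mat 1) A 0 (mat 1))"
    by (metis det_mul det_P det_S)
  then show ?thesis
    using nz by simp
qed

text \<open>\<open>M\<close> factors out on the left, and the remaining determinant shrinks from
  size \<open>'m\<close> to size \<open>'n\<close>. Stating it with \<open>M ** X\<close> avoids any
  inverse of \<open>M\<close>: a solution \<open>X\<close> of a linear system is supplied
  instead.\<close>

lemma det_minus_mult:
  fixes M :: "'a::field^'m^'m" and X :: "'a^'n^'m" and B :: "'a^'m^'n"
  shows "det (M - M ** X ** B) = det M * det (mat 1 - B ** X)"
proof -
  have "M ** (mat 1 - Y) = M ** mat 1 - M ** Y" for Y :: "'a^'m^'m"
    by (simp add: matrix_matrix_mult_def vec_eq_iff right_diff_distrib sum_subtractf
        del: matrix_mul_rid)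
  then have "M - M ** X ** B = M ** (mat 1 - X ** B)"
    by (simp add: matrix_mul_assoc)
  then show ?thesis
    by (simp only: det_mul det_one_minus_mult_commute [of X B])
qed

text \<open>A permutation with a nonzero Leibniz term never lowers the grade \<open>l\<close>, and
  the sum of all grades is invariant, so it preserves every grade. Inside one grade \<open>M\<close>
  is the identity, which leaves only \<open>id\<close>.\<close>

lemma det_graded_unipotent:
  fixes M :: "'a::comm_ring_1^'m^'m" and l :: "'m \<Rightarrow> nat"
  assumes diag: "\<And>x. M $ x $ x = 1"
    and upper: "\<And>x y. x \<noteq> y \<Longrightarrow> l y \<le> l x \<Longrightarrow> M $ x $ y = 0"
  shows "det M = 1"
proof -
  have id: "p = id" if p: "p permutes UNIV" and nz: "\<And>x. M $ x $ p x \<noteq> 0" for p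
  proof -
    have le: "l x \<le> l (p x)" for x
      using nz[of x] upper[of x "p x"] by (metis linear)
    have "(\<Sum>x\<in>UNIV. l (p x)) = (\<Sum>x\<in>UNIV. l x)"
      using sum.permute[OF p, of l] by (simp add: o_def)
    then have "l (p x) = l x" for x
      using le sum_strict_mono_ex1[of UNIV l "\<lambda>x. l (p x)"]
      by (metis UNIV_I finite le_neq_implies_less less_irrefl)
    then show ?thesis
      using nz upper unfolding fun_eq_iff id_apply by (metis order_refl)
  qed
  have "det M = (\<Sum>p\<in>{id}. of_int (sign p) * (\<Prod>x\<in>UNIV. M $ x $ p x))"
    unfolding det_def
  proof (rule sum.mono_neutral_right)
    show "\<forall>p\<in>{p. p permutes UNIV} - {id}. of_int (sign p) * (\<Prod>x\<in>UNIV. M $ x $ p x) = 0"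
    proof
      fix p assume p: "p \<in> {p. p permutes (UNIV :: 'm set)} - {id}"
      then have "\<exists>x. M $ x $ p x = 0"
        using id by blast
      then show "of_int (sign p) * (\<Prod>x\<in>UNIV. M $ x $ p x) = 0"
        by (metis finite iso_tuple_UNIV_I mult_zero_right prod_zero)
    qed
  qed (auto simp: permutes_id)
  then show ?thesis
    by (simp add: diag)
qed

section \<open>Paths and transition weights\<close>

lemma finite_paths:
  fixes V :: "nat \<Rightarrow> 'v::finite set"
  shows "finite (paths V E m n)"
  by (rule finite_subset [of _ "PiE {m..n} V"]) (auto simp: paths_def intro: finite_PiE)

lemma path_in_layer: "\<pi> \<in> paths V E m n \<Longrightarrow> m \<le> k \<Longrightarrow> k \<le> n \<Longrightarrow> \<pi> k \<in> V k"
  by (auto simp: paths_def PiE_def)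

lemma path_eqI:
  assumes "\<pi> \<in> paths V E m n" "\<pi>' \<in> paths V E m n" "\<And>k. m \<le> k \<Longrightarrow> k \<le> n \<Longrightarrow> \<pi> k = \<pi>' k"
  shows "\<pi> = \<pi>'"
  by (rule PiE_ext [of _ "{m..n}" V]) (use assms in \<open>simp_all add: paths_def\<close>)

lemma restrict_path:
  "\<pi> \<in> paths V E m n \<Longrightarrow> m \<le> a \<Longrightarrow> b \<le> n \<Longrightarrow> restrict \<pi> {a..b} \<in> paths V E a b"
  by (auto simp: paths_def PiE_def)

lemma join_path:
  assumes "\<alpha> \<in> paths V E m k" "\<beta> \<in> paths V E k n" "\<alpha> k = \<beta> k" "m \<le> k" "k \<le> n"
  shows "(\<lambda>i. if i \<le> k then \<alpha> i else \<beta> i) \<in> paths V E m n"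
proof -
  let ?\<pi> = "\<lambda>i. if i \<le> k then \<alpha> i else \<beta> i"
  have "?\<pi> \<in> PiE {m..n} V"
    using assms by (intro PiE_I) (auto simp: paths_def PiE_def extensional_def Pi_def)
  moreover have "(?\<pi> i, ?\<pi> (Suc i)) \<in> E" if "i \<in> {m..<n}" for i
  proof (cases "i < k")
    case True
    then show ?thesis using assms(1) that by (simp add: paths_def)
  next
    case False
    then have "(\<beta> i, \<beta> (Suc i)) \<in> E" using assms(2) that by (simp add: paths_def)
    then show ?thesis using False assms(3) by (cases "i = k") auto
  qed
  ultimately show ?thesis by (simp add: paths_def)
qed

lemma path_weight_split:
  assumes "m \<le> k" "k \<le> n"
  shows "path_weight w m n \<pi> = path_weight w m k \<pi> * path_weight w k n \<pi>"
  unfolding path_weight_def using assms by (simp add: prod.atLeastLessThan_concat)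

lemma path_weight_cong:
  "(\<And>i. m \<le> i \<Longrightarrow> i \<le> n \<Longrightarrow> \<pi> i = \<pi>' i) \<Longrightarrow> path_weight w m n \<pi> = path_weight w m n \<pi>'"
  unfolding path_weight_def by (intro prod.cong) auto

text \<open>Cutting a path at layer \<open>k\<close> and gluing two paths that agree there are
  inverse bijections, and weights multiply. This is the Chapman-Kolmogorov equation.\<close>

lemma \<W>_split:
  fixes V :: "nat \<Rightarrow> 'v::finite set"
  assumes "m \<le> k" "k \<le> n"
  shows "\<W> V E w m n x z = (\<Sum>y\<in>V k. \<W> V E w m k x y * \<W> V E w k n y z)"
proof -
  define P where "P m n x y = {\<pi> \<in> paths V E m n. \<pi> m = x \<and> \<pi> n = y}" for m n x y
  have fin: "finite (P m n x y)" for m n x y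
    by (simp add: P_def finite_paths)
  have "(\<Sum>y\<in>V k. \<W> V E w m k x y * \<W> V E w k n y z) =
      (\<Sum>(y, \<alpha>, \<beta>)\<in>Sigma (V k) (\<lambda>y. P m k x y \<times> P k n y z).
        path_weight w m k \<alpha> * path_weight w k n \<beta>)"
    by (simp add: \<W>_def P_def [symmetric] sum_product sum.cartesian_product sum.Sigma fin)
  also have "\<dots> = (\<Sum>\<pi>\<in>P m n x z. path_weight w m n \<pi>)"
  proof (rule sum.reindex_bij_witness [where
        j = "\<lambda>(y, \<alpha>, \<beta>) i. if i \<le> k then \<alpha> i else \<beta> i" and
        i = "\<lambda>\<pi>. (\<pi> k, restrict \<pi> {m..k}, restrict \<pi> {k..n})"])
    fix \<pi> assume "\<pi> \<in> P m n x z"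
    then have \<pi>: "\<pi> \<in> paths V E m n" "\<pi> m = x" "\<pi> n = z" by (auto simp: P_def)
    show "(\<pi> k, restrict \<pi> {m..k}, restrict \<pi> {k..n}) \<in> Sigma (V k) (\<lambda>y. P m k x y \<times> P k n y z)"
      using \<pi> assms by (auto simp: P_def intro: restrict_path path_in_layer)
    show "(case (\<pi> k, restrict \<pi> {m..k}, restrict \<pi> {k..n}) of
        (y, \<alpha>, \<beta>) \<Rightarrow> \<lambda>i. if i \<le> k then \<alpha> i else \<beta> i) = \<pi>"
      using \<pi>(1) assms by (auto simp: paths_def PiE_def extensional_def fun_eq_iff)
  next
    fix a assume "a \<in> Sigma (V k) (\<lambda>y. P m k x y \<times> P k n y z)"
    then obtain y \<alpha> \<beta> where a: "a = (y, \<alpha>, \<beta>)" and y: "y \<in> V k"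
      and \<alpha>: "\<alpha> \<in> paths V E m k" "\<alpha> m = x" "\<alpha> k = y"
      and \<beta>: "\<beta> \<in> paths V E k n" "\<beta> k = y" "\<beta> n = z"
      by (auto simp: P_def)
    let ?\<pi> = "\<lambda>i. if i \<le> k then \<alpha> i else \<beta> i"
    have \<pi>: "?\<pi> \<in> paths V E m n"
      using \<alpha> \<beta> assms by (intro join_path) auto
    have eq: "restrict ?\<pi> {m..k} = \<alpha>" "restrict ?\<pi> {k..n} = \<beta>"
      using \<alpha> \<beta> by (auto simp: paths_def PiE_def extensional_def fun_eq_iff)
    then show "(\<lambda>\<pi>. (\<pi> k, restrict \<pi> {m..k}, restrict \<pi> {k..n}))
        (case a of (y, \<alpha>, \<beta>) \<Rightarrow> \<lambda>i. if i \<le> k then \<alpha> i else \<beta> i) = a"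
      using \<alpha> by (simp add: a)
    show "(case a of (y, \<alpha>, \<beta>) \<Rightarrow> \<lambda>i. if i \<le> k then \<alpha> i else \<beta> i) \<in> P m n x z"
      using \<pi> \<alpha> \<beta> assms by (auto simp: P_def a)
    have "path_weight w m n ?\<pi> = path_weight w m k \<alpha> * path_weight w k n \<beta>"
      using \<alpha> \<beta> by (subst path_weight_split [OF assms])
        (auto intro!: arg_cong2 [where f = "(*)"] path_weight_cong)
    then show "path_weight w m n (case a of (y, \<alpha>, \<beta>) \<Rightarrow> \<lambda>i. if i \<le> k then \<alpha> i else \<beta> i) =
        (case a of (y, \<alpha>, \<beta>) \<Rightarrow> path_weight w m k \<alpha> * path_weight w k n \<beta>)"
      by (simp add: a)
  qed
  finally show ?thesis
    by (simp add: \<W>_def P_def)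
qed

text \<open>The membership of \<open>y\<close> in the layer matters: elsewhere there is no
  one-vertex path and the value would be \<open>0\<close> even for \<open>x = y\<close>.\<close>

lemma \<W>_refl:
  assumes "y \<in> V n"
  shows "\<W> V E w n n x y = of_bool (x = y)"
proof -
  let ?\<pi> = "restrict (\<lambda>_. y) {n}"
  have mem: "?\<pi> \<in> paths V E n n"
    using assms by (simp add: paths_def)
  have uniq: "\<pi> = ?\<pi>" if "\<pi> \<in> paths V E n n" "\<pi> n = y" for \<pi>
    by (rule path_eqI [OF that(1) mem]) (use that in \<open>simp add: le_antisym\<close>)
  have set_eq: "{\<pi> \<in> paths V E n n. \<pi> n = y \<and> \<pi> n = y} = {?\<pi>}"
    by (intro equalityI subsetI; unfold mem_Collect_eq singleton_iff; (elim conjE)?)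
      (erule uniq, assumption, use mem in simp)
  show ?thesis
  proof (cases "x = y")
    case True
    then show ?thesis
      unfolding \<W>_def True set_eq by (simp add: path_weight_def)
  next
    case False
    then have none: "{\<pi> \<in> paths V E n n. \<pi> n = x \<and> \<pi> n = y} = {}"
      by blast
    show ?thesis
      unfolding \<W>_def none using False by simp
  qed
qed

lemma \<W>_step:
  assumes "x \<in> V n" "y \<in> V (Suc n)"
  shows "\<W> V E w n (Suc n) x y = (if (x, y) \<in> E then w (x, y) else 0)"
proof (cases "(x, y) \<in> E")
  case True
  let ?\<pi> = "restrict (\<lambda>i. if i = n then x else y) {n..Suc n}"
  have mem: "?\<pi> \<in> paths V E n (Suc n)"
    using assms True by (auto simp: paths_def le_Suc_eq)
  have uniq: "\<pi> = ?\<pi>" if "\<pi> \<in> paths V E n (Suc n)" "\<pi> n = x" "\<pi> (Suc n) = y" for \<pi>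
    by (rule path_eqI [OF that(1) mem]) (use that in \<open>auto simp: le_Suc_eq\<close>)
  have "{\<pi> \<in> paths V E n (Suc n). \<pi> n = x \<and> \<pi> (Suc n) = y} = {?\<pi>}"
    by (intro equalityI subsetI; unfold mem_Collect_eq singleton_iff; (elim conjE)?)
      (erule uniq, assumption, assumption, use mem in simp)
  then show ?thesis
    using True by (simp add: \<W>_def path_weight_def)
next
  case False
  then have no: "{\<pi> \<in> paths V E n (Suc n). \<pi> n = x \<and> \<pi> (Suc n) = y} = {}"
    by (auto simp: paths_def)
  show ?thesis
    using False by (simp add: \<W>_def no)
qed

lemma \<phi>_layer_step:
  fixes V :: "nat \<Rightarrow> 'v::finite set"
  assumes "m \<le> n" "n \<le> T"
  shows "\<phi>_layer V E w T \<phi> m j x = (\<Sum>y\<in>V n. \<W> V E w m n x y * \<phi>_layer V E w T \<phi> n j y)"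
  by (simp add: \<phi>_layer_def \<W>_split [OF assms] sum_distrib_left sum_distrib_right mult.assoc
      sum.swap [of _ "V T"])

lemma \<psi>_layer_step:
  fixes V :: "nat \<Rightarrow> 'v::finite set"
  assumes "m \<le> n"
  shows "\<psi>_layer V E w \<psi> n j y = (\<Sum>x\<in>V m. \<psi>_layer V E w \<psi> m j x * \<W> V E w m n x y)"
  by (simp add: \<psi>_layer_def \<W>_split [OF le0 assms] sum_distrib_left sum_distrib_right mult.assoc
      sum.swap [of _ "V 0"])

lemma \<phi>_layer_last:
  fixes V :: "nat \<Rightarrow> 'v::finite set"
  shows "x \<in> V T \<Longrightarrow> \<phi>_layer V E w T \<phi> T j x = \<phi> j x"
  by (simp add: \<phi>_layer_def \<W>_refl of_bool_def if_distrib if_distribR cong: if_cong)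

lemma \<psi>_layer_0:
  fixes V :: "nat \<Rightarrow> 'v::finite set"
  shows "x \<in> V 0 \<Longrightarrow> \<psi>_layer V E w \<psi> 0 j x = \<psi> j x"
  by (simp add: \<psi>_layer_def \<W>_refl of_bool_def if_distrib if_distribR cong: if_cong)

text \<open>The transition weights pass from one factor of the pairing to the other, so
  biorthogonality on layer \<open>0\<close> propagates to every layer.\<close>

lemma sum_\<psi>_layer_\<phi>_layer:
  fixes V :: "nat \<Rightarrow> 'v::finite set"
  assumes "n \<le> T"
  shows "(\<Sum>x\<in>V n. \<psi>_layer V E w \<psi> n i x * \<phi>_layer V E w T \<phi> n j x) =
     (\<Sum>x\<in>V 0. \<psi> i x * \<phi>_layer V E w T \<phi> 0 j x)"
  by (simp add: \<phi>_layer_step [OF le0 assms] \<psi>_layer_def sum_distrib_left sum_distrib_right mult.assoc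
      sum.swap [of _ "V 0"])

section \<open>The partition function as a determinant\<close>

text \<open>The labelled form of non-intersecting collections. Injectivity layer by layer replaces
  disjointness of vertex sets, because it can be extended by one layer at a time.\<close>

definition path_tuples ::
    "(nat \<Rightarrow> 'v set) \<Rightarrow> ('v \<times> 'v) set \<Rightarrow> nat \<Rightarrow> ('n::finite \<Rightarrow> nat \<Rightarrow> 'v) set" where
  "path_tuples V E n = {\<pi>. (\<forall>j. \<pi> j \<in> paths V E 0 n) \<and> (\<forall>k\<le>n. inj (\<lambda>j. \<pi> j k))}"

lemma finite_path_tuples:
  fixes V :: "nat \<Rightarrow> 'v::finite set"
  shows "finite (path_tuples V E n :: ('n::finite \<Rightarrow> nat \<Rightarrow> 'v) set)"
  by (rule finite_subset [of _ "PiE UNIV (\<lambda>_. paths V E 0 n)"])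
    (auto simp: path_tuples_def intro: finite_PiE finite_paths)

lemma snoc_path:
  assumes "\<alpha> \<in> paths V E 0 n" "(\<alpha> n, y) \<in> E" "y \<in> V (Suc n)"
  shows "\<alpha>(Suc n := y) \<in> paths V E 0 (Suc n)"
proof -
  have "\<alpha>(Suc n := y) \<in> PiE {0..Suc n} V"
    using assms by (intro PiE_I) (auto simp: paths_def PiE_def extensional_def Pi_def)
  moreover have "((\<alpha>(Suc n := y)) k, (\<alpha>(Suc n := y)) (Suc k)) \<in> E" if "k \<in> {0..<Suc n}" for k
    using assms that by (cases "k = n") (auto simp: paths_def)
  ultimately show ?thesis by (simp add: paths_def)
qed

lemma path_weight_snoc:
  "path_weight w 0 (Suc n) (\<alpha>(Suc n := y)) = path_weight w 0 n \<alpha> * w (\<alpha> n, y)"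
  unfolding path_weight_def by (simp add: prod.atLeast0_lessThan_Suc)

lemma restrict_path_upd:
  "\<alpha> \<in> paths V E 0 n \<Longrightarrow> restrict (\<alpha>(Suc n := y)) {0..n} = \<alpha>"
  by (auto simp: paths_def PiE_def extensional_def fun_eq_iff)

lemma path_eq_restrict_upd:
  "\<pi> \<in> paths V E 0 (Suc n) \<Longrightarrow> (restrict \<pi> {0..n})(Suc n := \<pi> (Suc n)) = \<pi>"
  by (auto simp: paths_def PiE_def extensional_def fun_eq_iff)

lemma det_eq_0_if_not_inj:
  fixes f :: "'n::finite \<Rightarrow> 'v \<Rightarrow> real"
  assumes "\<not> inj x"
  shows "det ((\<chi> i j. f i (x j)) :: real^'n^'n) = 0"
proof -
  from assms obtain j k where "j \<noteq> k" "x j = x k"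
    by (auto simp: inj_on_def)
  then show ?thesis
    by (intro det_identical_columns [of j k]) (auto simp: column_def)
qed

text \<open>Induction over layers. The columns are expanded over the preceding vertices; a tuple
  with a repeated vertex gives equal columns and vanishes. Non-intersection thus arises from the
  determinant itself, without a path-swapping involution.\<close>

lemma det_\<psi>_layer:
  fixes V :: "nat \<Rightarrow> 'v::finite set" and y :: "'n::finite \<Rightarrow> 'v"
  assumes "\<And>j. y j \<in> V n" "inj y"
  shows "det ((\<chi> i j. \<psi>_layer V E w \<psi> n i (y j)) :: real^'n^'n) =
    (\<Sum>\<pi> | \<pi> \<in> path_tuples V E n \<and> (\<lambda>j. \<pi> j n) = y.
       det ((\<chi> i j. \<psi> i (\<pi> j 0)) :: real^'n^'n) * (\<Prod>j\<in>UNIV. path_weight w 0 n (\<pi> j)))"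
  using assms
proof (induction n arbitrary: y)
  case 0
  let ?\<pi> = "\<lambda>j. restrict (\<lambda>_. y j) {0}"
  have mem: "?\<pi> \<in> path_tuples V E 0"
    using 0 by (simp add: path_tuples_def paths_def)
  have uniq: "\<pi> = ?\<pi>" if \<pi>: "\<pi> \<in> path_tuples V E 0" and y: "(\<lambda>j. \<pi> j 0) = y" for \<pi>
  proof
    fix j
    show "\<pi> j = ?\<pi> j"
    proof (rule path_eqI)
      show "\<pi> j \<in> paths V E 0 0" "?\<pi> j \<in> paths V E 0 0"
        using \<pi> mem by (simp_all add: path_tuples_def)
      show "\<pi> j k = ?\<pi> j k" if "k \<le> 0" for k
        using that fun_cong [OF y, of j] by simp
    qed
  qed
  have tuples: "{\<pi>. \<pi> \<in> path_tuples V E 0 \<and> (\<lambda>j. \<pi> j 0) = y} = {?\<pi>}"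
    by (intro equalityI subsetI; unfold mem_Collect_eq singleton_iff; (elim conjE)?)
      (erule uniq, assumption, use mem in simp)
  show ?case
    unfolding tuples using 0 by (simp add: path_weight_def \<psi>_layer_0)
next
  case (Suc n)
  \<comment> \<open>The predecessor tuples that survive: no repeated vertex, and an edge from each
    \<open>x j\<close> to \<open>y j\<close>.\<close>
  define X where "X = {x :: 'n \<Rightarrow> 'v. (\<forall>j. x j \<in> V n) \<and> inj x \<and> (\<forall>j. (x j, y j) \<in> E)}"
  define D where "D \<pi> = det ((\<chi> i j. \<psi> i (\<pi> j 0)) :: real^'n^'n)" for \<pi> :: "'n \<Rightarrow> nat \<Rightarrow> 'v"
  define P where "P n y = {\<pi>. \<pi> \<in> path_tuples V E n \<and> (\<lambda>j. \<pi> j n) = y}" for n and y :: "'n \<Rightarrow> 'v"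
  have fin: "finite (P n y)" for n y
    unfolding P_def by (rule finite_subset [OF _ finite_path_tuples]) auto
  have "det ((\<chi> i j. \<psi>_layer V E w \<psi> (Suc n) i (y j)) :: real^'n^'n) =
      det ((\<chi> i j. \<Sum>x\<in>V n. \<psi>_layer V E w \<psi> n i x * \<W> V E w n (Suc n) x (y j)) :: real^'n^'n)"
    by (simp add: \<psi>_layer_step [of n "Suc n"])
  also have "\<dots> = (\<Sum>x | \<forall>j. x j \<in> V n. det ((\<chi> i j. \<psi>_layer V E w \<psi> n i (x j)) :: real^'n^'n) *
      (\<Prod>j\<in>UNIV. \<W> V E w n (Suc n) (x j) (y j)))"
    by (rule det_sum_columns) simp
  also have "\<dots> = (\<Sum>x\<in>X. det ((\<chi> i j. \<psi>_layer V E w \<psi> n i (x j)) :: real^'n^'n) *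
      (\<Prod>j\<in>UNIV. \<W> V E w n (Suc n) (x j) (y j)))"
  proof (rule sum.mono_neutral_right)
    show "\<forall>x\<in>{x. \<forall>j. x j \<in> V n} - X. det ((\<chi> i j. \<psi>_layer V E w \<psi> n i (x j)) :: real^'n^'n) *
      (\<Prod>j\<in>UNIV. \<W> V E w n (Suc n) (x j) (y j)) = 0"
    proof
      fix x assume x: "x \<in> {x. \<forall>j. x j \<in> V n} - X"
      show "det ((\<chi> i j. \<psi>_layer V E w \<psi> n i (x j)) :: real^'n^'n) *
        (\<Prod>j\<in>UNIV. \<W> V E w n (Suc n) (x j) (y j)) = 0"
      proof (cases "inj x")
        case True
        then obtain j where "(x j, y j) \<notin> E"
          using x by (auto simp: X_def)
        then have "\<W> V E w n (Suc n) (x j) (y j) = 0"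
          using x Suc.prems by (simp add: \<W>_step)
        then have "(\<Prod>j\<in>UNIV. \<W> V E w n (Suc n) (x j) (y j)) = 0"
          by (intro prod_zero) auto
        then show ?thesis by simp
      qed (simp add: det_eq_0_if_not_inj)
    qed
  qed (auto simp: X_def)
  also have "\<dots> = (\<Sum>x\<in>X. \<Sum>\<pi>\<in>P n x.
      D \<pi> * (\<Prod>j\<in>UNIV. path_weight w 0 n (\<pi> j)) * (\<Prod>j\<in>UNIV. w (x j, y j)))"
  proof (rule sum.cong [OF refl])
    fix x assume x: "x \<in> X"
    then have "(\<Prod>j\<in>UNIV. \<W> V E w n (Suc n) (x j) (y j)) = (\<Prod>j\<in>UNIV. w (x j, y j))"
      using Suc.prems by (intro prod.cong) (auto simp: X_def \<W>_step)
    then show "det ((\<chi> i j. \<psi>_layer V E w \<psi> n i (x j)) :: real^'n^'n) *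
        (\<Prod>j\<in>UNIV. \<W> V E w n (Suc n) (x j) (y j)) = (\<Sum>\<pi>\<in>P n x.
      D \<pi> * (\<Prod>j\<in>UNIV. path_weight w 0 n (\<pi> j)) * (\<Prod>j\<in>UNIV. w (x j, y j)))"
      using Suc.IH [of x] x by (simp add: X_def D_def P_def sum_distrib_right)
  qed
  also have "\<dots> = (\<Sum>(x, \<pi>)\<in>Sigma X (P n).
      D \<pi> * (\<Prod>j\<in>UNIV. path_weight w 0 n (\<pi> j)) * (\<Prod>j\<in>UNIV. w (x j, y j)))"
    by (subst sum.Sigma) (auto simp: fin)
  also have "\<dots> = (\<Sum>\<pi>\<in>P (Suc n) y. D \<pi> * (\<Prod>j\<in>UNIV. path_weight w 0 (Suc n) (\<pi> j)))"
  \<comment> \<open>Appending \<open>y j\<close> to path \<open>j\<close> is undone by reading off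
    layer \<open>n\<close> and truncating.\<close>
  proof (rule sum.reindex_bij_witness [where
        j = "\<lambda>(x, \<pi>) j. (\<pi> j)(Suc n := y j)" and
        i = "\<lambda>\<pi>. (\<lambda>j. \<pi> j n, \<lambda>j. restrict (\<pi> j) {0..n})"])
    fix a assume "a \<in> Sigma X (P n)"
    then obtain x \<pi> where a: "a = (x, \<pi>)" and x: "x \<in> X" and \<pi>: "\<And>j. \<pi> j \<in> paths V E 0 n"
      "\<And>k. k \<le> n \<Longrightarrow> inj (\<lambda>j. \<pi> j k)" and last: "\<And>j. \<pi> j n = x j"
      by (auto simp: P_def path_tuples_def)
    show "(\<lambda>\<pi>. (\<lambda>j. \<pi> j n, \<lambda>j. restrict (\<pi> j) {0..n}))
        (case a of (x, \<pi>) \<Rightarrow> \<lambda>j. (\<pi> j)(Suc n := y j)) = a"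
      by (simp add: a restrict_path_upd [OF \<pi>(1)] last del: restrict_upd)
    have "(\<lambda>j. (\<pi> j)(Suc n := y j)) \<in> path_tuples V E (Suc n)"
      using x \<pi> Suc.prems by (auto simp: path_tuples_def X_def last le_Suc_eq intro!: snoc_path)
    then show "(case a of (x, \<pi>) \<Rightarrow> \<lambda>j. (\<pi> j)(Suc n := y j)) \<in> P (Suc n) y"
      by (simp add: a P_def)
    show "D (case a of (x, \<pi>) \<Rightarrow> \<lambda>j. (\<pi> j)(Suc n := y j)) *
        (\<Prod>j\<in>UNIV. path_weight w 0 (Suc n) ((case a of (x, \<pi>) \<Rightarrow> \<lambda>j. (\<pi> j)(Suc n := y j)) j)) =
        (case a of (x, \<pi>) \<Rightarrow>
          D \<pi> * (\<Prod>j\<in>UNIV. path_weight w 0 n (\<pi> j)) * (\<Prod>j\<in>UNIV. w (x j, y j)))"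
      by (simp add: a D_def path_weight_snoc last prod.distrib)
  next
    fix \<pi> assume "\<pi> \<in> P (Suc n) y"
    then have \<pi>: "\<And>j. \<pi> j \<in> paths V E 0 (Suc n)" "\<And>k. k \<le> Suc n \<Longrightarrow> inj (\<lambda>j. \<pi> j k)"
      and last: "\<And>j. y j = \<pi> j (Suc n)"
      by (auto simp: P_def path_tuples_def)
    show "(case (\<lambda>j. \<pi> j n, \<lambda>j. restrict (\<pi> j) {0..n}) of (x, \<pi>) \<Rightarrow> \<lambda>j. (\<pi> j)(Suc n := y j)) = \<pi>"
      by (simp add: last path_eq_restrict_upd [OF \<pi>(1)])
    have "(\<lambda>j. \<pi> j n) \<in> X"
      using \<pi>(2) path_in_layer [OF \<pi>(1)] \<pi>(1) by (auto simp: X_def last) (simp add: paths_def)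
    moreover have "(\<lambda>j. restrict (\<pi> j) {0..n}) \<in> P n (\<lambda>j. \<pi> j n)"
      using \<pi>(2) restrict_path [OF \<pi>(1)] by (auto simp: P_def path_tuples_def)
    ultimately show "(\<lambda>j. \<pi> j n, \<lambda>j. restrict (\<pi> j) {0..n}) \<in> Sigma X (P n)"
      by simp
  qed
  finally show ?case
    by (simp add: P_def D_def)
qed

section \<open>From labelled path tuples to unordered collections\<close>

lemma bij_betw_if_mem_non_intersecting:
  assumes "\<P> \<in> non_intersecting V E T CARD('n::finite)"
  shows "bij_betw (SOME \<pi> :: 'n \<Rightarrow> _. bij_betw \<pi> UNIV \<P>) UNIV \<P>"
proof -
  have "card \<P> = CARD('n)"
    using assms by (simp add: non_intersecting_def)
  \<comment> \<open>\<open>card\<close> is \<open>0\<close> on infinite sets, whereas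
    \<open>CARD('n)\<close> is positive.\<close>
  then have "finite \<P>"
    by (metis card.infinite finite_UNIV_card_ge_0 finite less_numeral_extra(3))
  then have "\<exists>\<pi> :: 'n \<Rightarrow> _. bij_betw \<pi> UNIV \<P>"
    using \<open>card \<P> = CARD('n)\<close> by (intro finite_same_card_bij) auto
  then show ?thesis
    by (rule someI_ex)
qed

lemma finite_non_intersecting:
  fixes V :: "nat \<Rightarrow> 'v::finite set"
  shows "finite (non_intersecting V E T N)"
  by (rule finite_subset [of _ "Pow (paths V E 0 T)"]) (auto simp: non_intersecting_def finite_paths)

text \<open>Since the layers are disjoint, a vertex shared by two paths lies at the same time on
  both, where injectivity forbids it. Distinctness on layer \<open>0\<close> already gives the right
  cardinality.\<close>

lemma range_path_tuple:
  assumes disj: "disjoint_family_on V {..T}"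
    and \<pi>: "(\<pi> :: 'n::finite \<Rightarrow> _) \<in> path_tuples V E T"
  shows "range \<pi> \<in> non_intersecting V E T CARD('n)"
proof -
  have paths: "\<pi> j \<in> paths V E 0 T" for j
    using \<pi> by (simp add: path_tuples_def)
  have level: "j = j'" if "\<pi> j k = \<pi> j' k" "k \<le> T" for j j' k
    using \<pi> that by (auto simp: path_tuples_def inj_on_def)
  have "inj \<pi>"
    by (rule injI) (metis level le0)
  then have "card (range \<pi>) = CARD('n)"
    by (rule card_image)
  moreover have disj_paths: "disjnt (\<pi> j ` {0..T}) (\<pi> j' ` {0..T})" if "j \<noteq> j'" for j j'
    unfolding disjnt_iff
  proof (intro allI notI, elim conjE imageE)
    fix x k k' assume k: "x = \<pi> j k" "k \<in> {0..T}" "x = \<pi> j' k'" "k' \<in> {0..T}"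
    then have "x \<in> V k \<inter> V k'"
      using path_in_layer [OF paths, of k j] path_in_layer [OF paths, of k' j'] by simp
    then have "k = k'"
      using disj k by (auto simp: disjoint_family_on_def)
    then show False
      using k level that by auto
  qed
  ultimately show ?thesis
    using paths by (auto simp: non_intersecting_def pairwise_def) (metis disj_paths)
qed

lemma path_tuple_of_bij:
  assumes \<P>: "\<P> \<in> non_intersecting V E T N" and \<pi>: "bij_betw \<pi> UNIV \<P>"
  shows "\<pi> \<in> path_tuples V E T"
proof -
  have "\<pi> j k \<noteq> \<pi> j' k" if "k \<le> T" "j \<noteq> j'" for j j' k
  proof -
    have "\<pi> j \<in> \<P>" "\<pi> j' \<in> \<P>" "\<pi> j \<noteq> \<pi> j'"
      using \<pi> that by (auto simp: bij_betw_def inj_on_def)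
    then have "disjnt (\<pi> j ` {0..T}) (\<pi> j' ` {0..T})"
      using \<P> by (auto simp: non_intersecting_def pairwise_def)
    then show ?thesis
      unfolding disjnt_iff by (metis atLeastAtMost_iff imageI le0 that(1))
  qed
  then show ?thesis
    using \<P> \<pi> by (fastforce simp: path_tuples_def non_intersecting_def bij_betw_def inj_on_def)
qed

text \<open>All labellings are \<open>\<rho> \<circ> \<sigma>\<close> for one fixed
  \<open>\<rho>\<close>. The \<psi>-determinant picks up the sign of \<open>\<sigma>\<close> and the
  path weights do not change, so the sum over \<open>\<sigma>\<close> is the Leibniz expansion of
  the \<phi>-determinant.\<close>

lemma sum_labellings_eq_Wt:
  fixes \<psi> \<phi> :: "'n::finite \<Rightarrow> 'v::finite \<Rightarrow> real"
  assumes \<P>: "\<P> \<in> non_intersecting V E T CARD('n)"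
  shows "(\<Sum>\<pi> | \<pi> \<in> path_tuples V E T \<and> range \<pi> = \<P>.
      det ((\<chi> i j. \<psi> i (\<pi> j 0)) :: real^'n^'n) * (\<Prod>j\<in>UNIV. path_weight w 0 T (\<pi> j)) *
      (\<Prod>j\<in>UNIV. \<phi> j (\<pi> j T))) = Wt w T \<psi> \<phi> \<P>"
proof -
  define \<rho> :: "'n \<Rightarrow> nat \<Rightarrow> 'v" where "\<rho> = (SOME \<pi>. bij_betw \<pi> UNIV \<P>)"
  have \<rho>: "bij_betw \<rho> UNIV \<P>"
    unfolding \<rho>_def by (rule bij_betw_if_mem_non_intersecting [OF \<P>])
  then have inj: "inj \<rho>" and range: "range \<rho> = \<P>"
    by (auto simp: bij_betw_def)
  let ?A = "det ((\<chi> i j. \<psi> i (\<rho> j 0)) :: real^'n^'n)"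
  let ?W = "\<Prod>j\<in>UNIV. path_weight w 0 T (\<rho> j)"
  have "(\<Sum>\<pi> | \<pi> \<in> path_tuples V E T \<and> range \<pi> = \<P>.
      det ((\<chi> i j. \<psi> i (\<pi> j 0)) :: real^'n^'n) * (\<Prod>j\<in>UNIV. path_weight w 0 T (\<pi> j)) *
      (\<Prod>j\<in>UNIV. \<phi> j (\<pi> j T))) =
    (\<Sum>\<sigma> | \<sigma> permutes UNIV. ?A * ?W * (of_int (sign \<sigma>) * (\<Prod>j\<in>UNIV. \<phi> j (\<rho> (\<sigma> j) T))))"
  proof (rule sum.reindex_bij_witness [where i = "\<lambda>\<sigma>. \<rho> \<circ> \<sigma>" and j = "\<lambda>\<pi>. inv \<rho> \<circ> \<pi>"])
    fix \<pi> :: "'n \<Rightarrow> nat \<Rightarrow> 'v" assume "\<pi> \<in> {\<pi>. \<pi> \<in> path_tuples V E T \<and> range \<pi> = \<P>}"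
    then have \<pi>: "\<pi> \<in> path_tuples V E T" "range \<pi> = \<P>" by auto
    have "inj \<pi>"
      using \<pi>(1) by (auto simp: path_tuples_def inj_on_def)
    then have bij: "bij_betw \<pi> UNIV \<P>"
      using \<pi>(2) by (simp add: bij_betw_def)
    let ?\<sigma> = "inv \<rho> \<circ> \<pi>"
    have \<sigma>: "?\<sigma> permutes UNIV"
      using bij_betw_trans [OF bij bij_betw_inv_into [OF \<rho>]] by (intro bij_imp_permutes) auto
    then show "?\<sigma> \<in> {\<sigma>. \<sigma> permutes UNIV}" by simp
    have \<pi>_eq: "\<pi> j = \<rho> (?\<sigma> j)" for j
      using \<pi>(2) range by (metis comp_apply f_inv_into_f rangeI)
    then show "\<rho> \<circ> ?\<sigma> = \<pi>"
      by (simp add: fun_eq_iff)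
    have "det ((\<chi> i j. \<psi> i (\<pi> j 0)) :: real^'n^'n) =
        det ((\<chi> i j. (\<chi> i j. \<psi> i (\<rho> j 0)) $ i $ ?\<sigma> j) :: real^'n^'n)"
      by (subst \<pi>_eq) simp
    also have "\<dots> = of_int (sign ?\<sigma>) * ?A"
      by (rule det_permute_columns [OF \<sigma>])
    finally have "det ((\<chi> i j. \<psi> i (\<pi> j 0)) :: real^'n^'n) = of_int (sign ?\<sigma>) * ?A" .
    moreover have "(\<Prod>j\<in>UNIV. path_weight w 0 T (\<pi> j)) = ?W"
      by (simp only: prod.reindex_bij_betw [OF bij] prod.reindex_bij_betw [OF \<rho>])
    moreover have "(\<Prod>j\<in>UNIV. \<phi> j (\<pi> j T)) = (\<Prod>j\<in>UNIV. \<phi> j (\<rho> (?\<sigma> j) T))"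
      by (subst \<pi>_eq) simp
    ultimately show "?A * ?W * (of_int (sign ?\<sigma>) * (\<Prod>j\<in>UNIV. \<phi> j (\<rho> (?\<sigma> j) T))) =
        det ((\<chi> i j. \<psi> i (\<pi> j 0)) :: real^'n^'n) * (\<Prod>j\<in>UNIV. path_weight w 0 T (\<pi> j)) *
        (\<Prod>j\<in>UNIV. \<phi> j (\<pi> j T))"
      by simp
  next
    fix \<sigma> :: "'n \<Rightarrow> 'n" assume "\<sigma> \<in> {\<sigma>. \<sigma> permutes UNIV}"
    then have "bij \<sigma>" by (simp add: permutes_bij)
    show "inv \<rho> \<circ> (\<rho> \<circ> \<sigma>) = \<sigma>"
      using inj by (simp add: fun_eq_iff)
    have "bij_betw (\<rho> \<circ> \<sigma>) UNIV \<P>"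
      using \<open>bij \<sigma>\<close> \<rho> by (rule bij_betw_trans)
    then show "\<rho> \<circ> \<sigma> \<in> {\<pi>. \<pi> \<in> path_tuples V E T \<and> range \<pi> = \<P>}"
      using path_tuple_of_bij [OF \<P>] unfolding mem_Collect_eq bij_betw_def by blast
  qed
  also have "\<dots> = ?A * ?W * det ((\<chi> i j. \<phi> i (\<rho> j T)) :: real^'n^'n)"
    by (simp add: det_def sum_distrib_left)
  finally show ?thesis
    by (simp add: Wt_def Let_def \<rho>_def)
qed

text \<open>The pairing is moved to layer \<open>T\<close> and expanded over endpoints, which
  \<open>det_\<psi>_layer\<close> turns into path tuples. Any weights are allowed: it is applied
  both to \<open>w\<close> and to the weights modified by \<open>q\<close>.\<close>

lemma Z_total_eq_det:
  fixes V :: "nat \<Rightarrow> 'v::finite set" and \<psi> \<phi> :: "'n::finite \<Rightarrow> 'v \<Rightarrow> real"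
  assumes disj: "disjoint_family_on V {..T}"
  shows "Z_total V E w T \<psi> \<phi> =
    det ((\<chi> i j. \<Sum>x\<in>V 0. \<psi> i x * \<phi>_layer V E w T \<phi> 0 j x) :: real^'n^'n)"
proof -
  define F where "F \<pi> = det ((\<chi> i j. \<psi> i (\<pi> j 0)) :: real^'n^'n) *
    (\<Prod>j\<in>UNIV. path_weight w 0 T (\<pi> j)) * (\<Prod>j\<in>UNIV. \<phi> j (\<pi> j T))" for \<pi> :: "'n \<Rightarrow> nat \<Rightarrow> 'v"
  have "det ((\<chi> i j. \<Sum>x\<in>V 0. \<psi> i x * \<phi>_layer V E w T \<phi> 0 j x) :: real^'n^'n) =
      det ((\<chi> i j. \<Sum>x\<in>V T. \<psi>_layer V E w \<psi> T i x * \<phi> j x) :: real^'n^'n)"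
    by (simp add: sum_\<psi>_layer_\<phi>_layer [OF order_refl, symmetric] \<phi>_layer_last)
  also have "\<dots> = (\<Sum>y | \<forall>j. y j \<in> V T.
      det ((\<chi> i j. \<psi>_layer V E w \<psi> T i (y j)) :: real^'n^'n) * (\<Prod>j\<in>UNIV. \<phi> j (y j)))"
    by (rule det_sum_columns) simp
  also have "\<dots> = (\<Sum>y | (\<forall>j. y j \<in> V T) \<and> inj y.
      det ((\<chi> i j. \<psi>_layer V E w \<psi> T i (y j)) :: real^'n^'n) * (\<Prod>j\<in>UNIV. \<phi> j (y j)))"
    by (rule sum.mono_neutral_right) (auto simp: det_eq_0_if_not_inj)
  also have "\<dots> = (\<Sum>y | (\<forall>j. y j \<in> V T) \<and> inj y.
      \<Sum>\<pi> | \<pi> \<in> path_tuples V E T \<and> (\<lambda>j. \<pi> j T) = y. F \<pi>)"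
    by (intro sum.cong refl) (auto simp: det_\<psi>_layer F_def sum_distrib_right intro!: sum.cong)
  \<comment> \<open>Tuples are ungrouped from their endpoints, then regrouped by the collection they
    label.\<close>
  also have "\<dots> = sum F (path_tuples V E T)"
    by (rule sum.group) (use finite_path_tuples in \<open>auto simp: path_tuples_def intro: path_in_layer\<close>)
  also have "\<dots> = (\<Sum>\<P>\<in>non_intersecting V E T CARD('n).
      \<Sum>\<pi> | \<pi> \<in> path_tuples V E T \<and> range \<pi> = \<P>. F \<pi>)"
    by (rule sum.group [symmetric])
      (auto simp: finite_path_tuples finite_non_intersecting range_path_tuple [OF disj])
  also have "\<dots> = Z_total V E w T \<psi> \<phi>"
    unfolding Z_total_def F_def by (intro sum.cong refl sum_labellings_eq_Wt)
  finally show ?thesis ..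
qed

section \<open>The extended kernel\<close>

lemma layer_of_eq:
  assumes "disjoint_family_on V {..T}" "n \<le> T" "x \<in> V n"
  shows "layer_of V T x = n"
  unfolding layer_of_def
  by (rule the_equality) (use assms in \<open>auto simp: disjoint_family_on_def\<close>)

lemma layer_of_cover:
  assumes "(\<Union>n\<le>T. V n) = UNIV" "disjoint_family_on V {..T}"
  shows "layer_of V T x \<le> T" "x \<in> V (layer_of V T x)"
proof -
  obtain n where "n \<le> T" "x \<in> V n"
    using assms(1) by blast
  then show "layer_of V T x \<le> T" "x \<in> V (layer_of V T x)"
    using layer_of_eq [OF assms(2)] by auto
qed

lemma sum_layers:
  fixes V :: "nat \<Rightarrow> 'v::finite set" and f :: "nat \<Rightarrow> 'v \<Rightarrow> 'a::comm_monoid_add"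
  assumes cover: "(\<Union>n\<le>T. V n) = UNIV" and disj: "disjoint_family_on V {..T}"
  shows "(\<Sum>x\<in>UNIV. f (layer_of V T x) x) = (\<Sum>n\<le>T. \<Sum>x\<in>V n. f n x)"
proof -
  have "(\<Sum>x\<in>UNIV. f (layer_of V T x) x) = (\<Sum>n\<le>T. \<Sum>x\<in>V n. f (layer_of V T x) x)"
    unfolding cover [symmetric]
    by (rule sum.UNION_disjoint) (use disj in \<open>auto simp: disjoint_family_on_def\<close>)
  then show ?thesis
    using layer_of_eq [OF disj] by simp
qed

text \<open>Both cases of the kernel become a rank \<open>N\<close> term minus a strictly upper
  triangular one. For \<open>m \<le> n\<close> the weights carry \<open>\<phi>_layer\<close> from
  layer \<open>n\<close> to layer \<open>m\<close>; for \<open>m > n\<close> biorthogonality pins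
  down the chosen coefficients.\<close>

lemma K_ext_eq:
  fixes V :: "nat \<Rightarrow> 'v::finite set" and \<psi> \<phi> :: "'n::finite \<Rightarrow> 'v \<Rightarrow> real"
  assumes biorth: "\<And>i j. (\<Sum>x\<in>V 0. \<psi> i x * \<phi>_layer V E w T \<phi> 0 j x) = of_bool (i = j)"
    and m: "x \<in> V m" "m \<le> T" and n: "y \<in> V n" "n \<le> T"
  shows "K_ext V E w T \<psi> \<phi> (m, x) (n, y) =
    (\<Sum>i\<in>UNIV. \<phi>_layer V E w T \<phi> m i x * \<psi>_layer V E w \<psi> n i y) -
    (if m < n then \<W> V E w m n x y else 0)"
proof -
  let ?\<phi> = "\<phi>_layer V E w T \<phi>" and ?\<psi> = "\<psi>_layer V E w \<psi>"
  let ?K = "K_layer V E w T \<psi> \<phi>"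
  have apply_K: "(\<Sum>z\<in>V n. \<W> V E w m n x z * ?K n z y) = (\<Sum>i\<in>UNIV. ?\<phi> m i x * ?\<psi> n i y)"
    if "m \<le> n"
    by (simp add: K_layer_def \<phi>_layer_step [OF that n(2)] sum_distrib_left sum_distrib_right
        mult.assoc sum.swap [of _ "V n"])
  consider "m < n" | "m = n" | "n < m" by linarith
  then show ?thesis
  proof cases
    case 1
    have "(\<Sum>z\<in>V n. \<W> V E w m n x z * of_bool (z = y)) = \<W> V E w m n x y"
      using n(1) by (simp add: of_bool_def mult_delta_right)
    then show ?thesis
      using 1 apply_K by (simp add: K_ext_def \<W>_op_def right_diff_distrib sum_subtractf)
  next
    case 2
    then show ?thesis
      using apply_K by (simp add: K_ext_def \<W>_op_def)
  next
    case 3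
    define represents where "represents c \<longleftrightarrow> (\<forall>z\<in>V n. ?K n z y = (\<Sum>i\<in>UNIV. c i * ?\<phi> n i z))" for c
    define c where "c = (SOME c. represents c)"
    have "represents (\<lambda>i. ?\<psi> n i y)"
      by (simp add: represents_def K_layer_def mult.commute)
    then have c: "represents c"
      unfolding c_def by (rule someI [of represents])
    \<comment> \<open>Pairing with the \<open>k\<close>-th \<psi>-function reads off the
      \<open>k\<close>-th coefficient, so every representation agrees with the evident one.\<close>
    have pairing: "(\<Sum>z\<in>V n. ?\<psi> n k z * ?K n z y) = d k" if "represents d" for d k
    proof -
      have "(\<Sum>z\<in>V n. ?\<psi> n k z * ?K n z y) = (\<Sum>z\<in>V n. \<Sum>i\<in>UNIV. d i * (?\<psi> n k z * ?\<phi> n i z))"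
        using that by (simp add: represents_def sum_distrib_left mult.left_commute)
      also have "\<dots> = (\<Sum>i\<in>UNIV. d i * (\<Sum>z\<in>V n. ?\<psi> n k z * ?\<phi> n i z))"
        by (simp add: sum_distrib_left sum.swap [of _ "V n"])
      also have "\<dots> = d k"
        by (simp add: sum_\<psi>_layer_\<phi>_layer [OF n(2)] biorth of_bool_def if_distrib cong: if_cong)
      finally show ?thesis .
    qed
    have "c k = ?\<psi> n k y" for k
      using pairing [OF c] pairing [OF \<open>represents (\<lambda>i. ?\<psi> n i y)\<close>] by simp
    then show ?thesis
      using 3 by (simp add: K_ext_def \<W>_op_def Let_def c_def [unfolded represents_def, symmetric]
          mult.commute)
  qed
qed

section \<open>Discounted weights and the resulting linear system\<close>

text \<open>Multiplying the weight of an edge leaving \<open>(n, x)\<close> by \<open>1 - q\<^sub>n(x)\<close> turns the expectation on the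
  left of the theorem into the partition function of the modified graph.\<close>

definition discounted ::
    "(nat \<Rightarrow> 'v set) \<Rightarrow> nat \<Rightarrow> (nat \<Rightarrow> 'v \<Rightarrow> real) \<Rightarrow> ('v \<times> 'v \<Rightarrow> real) \<Rightarrow> 'v \<times> 'v \<Rightarrow> real" where
  "discounted V T q w e = (1 - q (layer_of V T (fst e)) (fst e)) * w e"

lemma \<W>_discounted_step:
  assumes "disjoint_family_on V {..T}" "n < T" "x \<in> V n" "y \<in> V (Suc n)"
  shows "\<W> V E (discounted V T q w) n (Suc n) x y = (1 - q n x) * \<W> V E w n (Suc n) x y"
  using assms by (simp add: \<W>_step discounted_def layer_of_eq [of V T n])

text \<open>A path leaves each layer \<open>n < T\<close> by exactly one edge and so collects each
  factor once; both determinants depend on endpoints only.\<close>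

lemma Wt_discounted:
  fixes V :: "nat \<Rightarrow> 'v::finite set" and \<psi> \<phi> :: "'n::finite \<Rightarrow> 'v \<Rightarrow> real"
  assumes disj: "disjoint_family_on V {..T}"
    and \<P>: "\<P> \<in> non_intersecting V E T CARD('n)"
  shows "Wt (discounted V T q w) T \<psi> \<phi> \<P> = (\<Prod>\<pi>\<in>\<P>. \<Prod>n<T. 1 - q n (\<pi> n)) * Wt w T \<psi> \<phi> \<P>"
proof -
  define \<rho> :: "'n \<Rightarrow> nat \<Rightarrow> 'v" where "\<rho> = (SOME \<pi>. bij_betw \<pi> UNIV \<P>)"
  have \<rho>: "bij_betw \<rho> UNIV \<P>"
    unfolding \<rho>_def by (rule bij_betw_if_mem_non_intersecting [OF \<P>])
  have "path_weight (discounted V T q w) 0 T (\<rho> j) = (\<Prod>n<T. 1 - q n (\<rho> j n)) * path_weight w 0 T (\<rho> j)"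
    for j
  proof -
    have "\<rho> j \<in> paths V E 0 T"
      using \<rho> \<P> by (auto simp: bij_betw_def non_intersecting_def)
    then have "layer_of V T (\<rho> j n) = n" if "n < T" for n
      using that by (intro layer_of_eq [OF disj]) (auto intro: path_in_layer)
    then show ?thesis
      by (simp add: path_weight_def discounted_def prod.distrib atLeast0LessThan)
  qed
  then show ?thesis
    by (simp add: Wt_def Let_def \<rho>_def [symmetric] prod.distrib
        flip: prod.reindex_bij_betw [OF \<rho>])
qed

context
  fixes T :: nat and V :: "nat \<Rightarrow> 'v::finite set" and E :: "('v \<times> 'v) set"
    and w :: "'v \<times> 'v \<Rightarrow> real" and \<phi> :: "'n::finite \<Rightarrow> 'v \<Rightarrow> real" and q :: "nat \<Rightarrow> 'v \<Rightarrow> real"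
  assumes disj: "disjoint_family_on V {..T}"
begin

abbreviation "\<phi>q \<equiv> \<phi>_layer V E (discounted V T q w) T \<phi>"

text \<open>\<open>loss\<close> is the explicit solution \<open>X\<close> of \<open>(I + Q U) X = Q \<Phi>\<close>.\<close>

definition "continuation n j x =
  (if n < T then \<Sum>z\<in>V (Suc n). \<W> V E w n (Suc n) x z * \<phi>q (Suc n) j z else \<phi> j x)"

definition "loss n j x = (if n < T then q n x * continuation n j x else 0)"

text \<open>\<open>continuation\<close> takes its first step with the original weight and all later
  ones discounted; \<open>loss\<close> is what the discount at \<open>x\<close> removes. On layer
  \<open>T\<close> nothing is lost, as \<open>Q\<close> vanishes there.\<close>

lemma \<phi>q_eq:
  assumes "n \<le> T" "x \<in> V n"
  shows "\<phi>q n j x = continuation n j x - loss n j x"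
proof (cases "n = T")
  case True
  then show ?thesis
    using assms by (simp add: continuation_def loss_def \<phi>_layer_last)
next
  case False
  then have "n < T" using assms by simp
  then have "\<phi>q n j x = (\<Sum>z\<in>V (Suc n). (1 - q n x) * (\<W> V E w n (Suc n) x z * \<phi>q (Suc n) j z))"
    using assms by (subst \<phi>_layer_step [of n "Suc n"]) (simp_all add: \<W>_discounted_step [OF disj] mult.assoc)
  then show ?thesis
    using \<open>n < T\<close> by (simp add: continuation_def loss_def left_diff_distrib sum_subtractf sum_distrib_left)
qed

text \<open>A Duhamel formula, by downward induction from \<open>T\<close>: the losses at later
  layers, carried back by the original weights, make up the difference. Multiplied by
  \<open>q n x\<close> for \<open>n < T\<close>, it is row \<open>x\<close> of
  \<open>(I + Q U) X = Q \<Phi>\<close>.\<close>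

lemma \<phi>_layer_eq_continuation:
  assumes "n \<le> T" "x \<in> V n"
  shows "\<phi>_layer V E w T \<phi> n j x =
    continuation n j x + (\<Sum>k=Suc n..T. \<Sum>y\<in>V k. \<W> V E w n k x y * loss k j y)"
  using assms
proof (induction n arbitrary: x rule: inc_induct)
  case base
  then show ?case
    by (simp add: continuation_def \<phi>_layer_last)
next
  case (step n)
  \<comment> \<open>\<open>continuation\<close> is \<open>\<phi>q\<close> plus \<open>loss\<close>,
    and that loss becomes the new first summand \<open>k = Suc n\<close>, where the weight matrix is
    the identity.\<close>
  have IH: "\<phi>_layer V E w T \<phi> (Suc n) j z =
      \<phi>q (Suc n) j z + (\<Sum>k=Suc n..T. \<Sum>y\<in>V k. \<W> V E w (Suc n) k z y * loss k j y)"
    if z: "z \<in> V (Suc n)" for z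
  proof -
    have "(\<Sum>k=Suc n..T. \<Sum>y\<in>V k. \<W> V E w (Suc n) k z y * loss k j y) =
        loss (Suc n) j z + (\<Sum>k=Suc (Suc n)..T. \<Sum>y\<in>V k. \<W> V E w (Suc n) k z y * loss k j y)"
      using step.hyps z
      by (simp add: sum.atLeast_Suc_atMost [of "Suc n" T] \<W>_refl of_bool_def if_distrib if_distribR
          cong: if_cong)
    then show ?thesis
      using step.IH [OF z] \<phi>q_eq [OF _ z] step.hyps by simp
  qed
  have "\<phi>_layer V E w T \<phi> n j x =
      (\<Sum>z\<in>V (Suc n). \<W> V E w n (Suc n) x z * \<phi>_layer V E w T \<phi> (Suc n) j z)"
    using step.hyps by (intro \<phi>_layer_step) auto
  also have "\<dots> = continuation n j x + (\<Sum>z\<in>V (Suc n). \<W> V E w n (Suc n) x z *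
      (\<Sum>k=Suc n..T. \<Sum>y\<in>V k. \<W> V E w (Suc n) k z y * loss k j y))"
    using step.hyps by (simp add: IH distrib_left sum.distrib continuation_def)
  also have "(\<Sum>z\<in>V (Suc n). \<W> V E w n (Suc n) x z *
      (\<Sum>k=Suc n..T. \<Sum>y\<in>V k. \<W> V E w (Suc n) k z y * loss k j y)) =
      (\<Sum>k=Suc n..T. \<Sum>y\<in>V k. (\<Sum>z\<in>V (Suc n). \<W> V E w n (Suc n) x z * \<W> V E w (Suc n) k z y) * loss k j y)"
    by (simp add: sum_distrib_left sum_distrib_right mult.assoc sum.swap [of _ _ "V (Suc n)"])
  also have "\<dots> = (\<Sum>k=Suc n..T. \<Sum>y\<in>V k. \<W> V E w n k x y * loss k j y)"
    by (intro sum.cong refl) (simp add: \<W>_split [of n "Suc n"])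
  finally show ?case .
qed

text \<open>Here the losses include layer \<open>0\<close>, so that pairing with
  \<open>\<psi>\<close> yields all of \<open>\<Psi> ** X\<close>.\<close>

lemma \<phi>_layer_0_eq:
  assumes "x \<in> V 0"
  shows "\<phi>_layer V E w T \<phi> 0 j x =
    \<phi>q 0 j x + (\<Sum>k\<le>T. \<Sum>y\<in>V k. \<W> V E w 0 k x y * loss k j y)"
  using \<phi>_layer_eq_continuation [of 0 x j] \<phi>q_eq [of 0 x j] assms
  by (simp add: atMost_atLeast0 sum.atLeast_Suc_atMost [of 0 T] \<W>_refl of_bool_def if_distrib if_distribR
      cong: if_cong)

end

section \<open>Assembly of the determinant identity\<close>

theorem corollary1p4:
  fixes T :: nat
    and V :: "nat \<Rightarrow> 'v::finite set"
    and E :: "('v \<times> 'v) set"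
    and w :: "'v \<times> 'v \<Rightarrow> real"
    and \<psi> \<phi> :: "'n::finite \<Rightarrow> 'v \<Rightarrow> real"
    and q :: "nat \<Rightarrow> 'v \<Rightarrow> real"
  assumes layers_cover: "(\<Union>n\<le>T. V n) = UNIV"
    and layers_disjoint: "disjoint_family_on V {..T}"
    and edges: "E \<subseteq> (\<Union>n<T. V n \<times> V (Suc n))"
    and dag: "acyclic E"
    and planar: "planar_digraph E"
    and biorthogonal: "\<And>i j. (\<Sum>x\<in>V 0. \<psi> i x * \<phi>_layer V E w T \<phi> 0 j x) = of_bool (i = j)"
    and Z_nonzero: "Z_total V E w T \<psi> \<phi> \<noteq> 0"
  shows "(\<Sum>\<P>\<in>non_intersecting V E T CARD('n).
            (\<Prod>\<pi>\<in>\<P>. \<Prod>n<T. 1 - q n (\<pi> n)) * \<nu> V E w T \<psi> \<phi> \<P>)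
         = det (mat 1 - Q_matrix V T q ** K_ext_matrix V E w T \<psi> \<phi>)"
proof -
  note layer = layer_of_cover [OF layers_cover layers_disjoint]
  let ?l = "layer_of V T" and ?g = "discounted V T q w"
  let ?X = "loss T V E w \<phi> q" and ?Y = "continuation T V E w \<phi> q"
  define X :: "real^'n^'v" where "X = (\<chi> x j. ?X (?l x) j x)"
  define \<Phi> :: "real^'n^'v" where "\<Phi> = (\<chi> x j. \<phi>_layer V E w T \<phi> (?l x) j x)"
  define \<Psi> :: "real^'v^'n" where "\<Psi> = (\<chi> i y. \<psi>_layer V E w \<psi> (?l y) i y)"
  define U :: "real^'v^'v" where
    "U = (\<chi> x y. if ?l x < ?l y then \<W> V E w (?l x) (?l y) x y else 0)"
  define Q where "Q = Q_matrix V T q"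
  define M where "M = mat 1 + Q ** U"

  have Q_mult: "(Q ** A) $ x $ j = (if ?l x < T then q (?l x) x else 0) * A $ x $ j"
    for A :: "real^'m^'v" and x j
    by (cases "?l x < T")
      (simp_all add: Q_def Q_matrix_def matrix_matrix_mult_def mult_delta_left)
  have K: "K_ext_matrix V E w T \<psi> \<phi> = \<Phi> ** \<Psi> - U"
    by (simp add: K_ext_matrix_def K_ext_eq [OF biorthogonal] layer vec_eq_iff
        matrix_matrix_mult_def \<Phi>_def \<Psi>_def U_def)
  \<comment> \<open>Strict triangularity of \<open>U\<close> cuts the sum down to layers beyond that
    of \<open>x\<close>, the sum in the Duhamel formula.\<close>
  have U_X: "(U ** X) $ x $ j = \<phi>_layer V E w T \<phi> (?l x) j x - ?Y (?l x) j x" for x j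
  proof -
    have "(U ** X) $ x $ j =
        (\<Sum>y\<in>UNIV. (if ?l x < ?l y then \<W> V E w (?l x) (?l y) x y else 0) * ?X (?l y) j y)"
      by (simp add: matrix_matrix_mult_def U_def X_def)
    also have "\<dots> = (\<Sum>k\<le>T. \<Sum>y\<in>V k. (if ?l x < k then \<W> V E w (?l x) k x y else 0) * ?X k j y)"
      by (rule sum_layers [OF layers_cover layers_disjoint])
    also have "\<dots> = (\<Sum>k=Suc (?l x)..T. \<Sum>y\<in>V k. \<W> V E w (?l x) k x y * ?X k j y)"
      by (rule sum.mono_neutral_cong_right) auto
    finally show ?thesis
      using \<phi>_layer_eq_continuation [OF layers_disjoint layer [of x],
          where j = j and q = q and w = w and \<phi> = \<phi> and E = E] by simp
  qed
  have M_X: "M ** X = Q ** \<Phi>"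
  proof -
    have distrib: "(mat 1 + A) ** X = mat 1 ** X + A ** X" for A
      by (simp add: matrix_matrix_mult_def vec_eq_iff distrib_right sum.distrib
          del: matrix_mul_lid)
    have "(M ** X) $ x $ j = (Q ** \<Phi>) $ x $ j" for x j
    proof -
      have "(M ** X) $ x $ j = X $ x $ j + (Q ** (U ** X)) $ x $ j"
        by (simp add: M_def distrib matrix_mul_assoc)
      also have "\<dots> = (Q ** \<Phi>) $ x $ j"
        unfolding Q_mult U_X
        by (simp add: X_def \<Phi>_def loss_def [OF layers_disjoint] right_diff_distrib)
      finally show ?thesis .
    qed
    then show ?thesis by (simp add: vec_eq_iff)
  qed
  \<comment> \<open>Expanding the kernel gives \<open>M - Q ** \<Phi> ** \<Psi>\<close>, and
    \<open>M_X\<close> brings it to the form of \<open>det_minus_mult\<close>.\<close>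
  have "mat 1 - Q ** K_ext_matrix V E w T \<psi> \<phi> = M - M ** X ** \<Psi>"
  proof -
    have "Q ** (\<Phi> ** \<Psi> - U) = Q ** (\<Phi> ** \<Psi>) - Q ** U"
      by (simp add: vec_eq_iff Q_mult right_diff_distrib)
    then show ?thesis
      unfolding K M_X by (simp add: M_def matrix_mul_assoc)
  qed
  then have "det (mat 1 - Q ** K_ext_matrix V E w T \<psi> \<phi>) = det M * det (mat 1 - \<Psi> ** X)"
    by (simp add: det_minus_mult)
  also have "det M = 1"
    by (rule det_graded_unipotent [where l = ?l]) (simp_all add: M_def Q_mult, simp_all add: U_def mat_def)
  \<comment> \<open>\<open>\<Psi> ** X\<close> is the total loss in the pairings. The original
    pairings form the identity matrix, so what remains is the matrix of discounted pairings.\<close>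
  also have "mat 1 - \<Psi> ** X = (\<chi> i j. \<Sum>x\<in>V 0. \<psi> i x * \<phi>_layer V E ?g T \<phi> 0 j x)"
  proof -
    have "(\<Psi> ** X) $ i $ j + (\<Sum>x\<in>V 0. \<psi> i x * \<phi>_layer V E ?g T \<phi> 0 j x) = of_bool (i = j)" for i j
    proof -
      have "(\<Psi> ** X) $ i $ j = (\<Sum>y\<in>UNIV. \<psi>_layer V E w \<psi> (?l y) i y * ?X (?l y) j y)"
        by (simp add: matrix_matrix_mult_def \<Psi>_def X_def)
      also have "\<dots> = (\<Sum>k\<le>T. \<Sum>y\<in>V k. \<psi>_layer V E w \<psi> k i y * ?X k j y)"
        by (rule sum_layers [OF layers_cover layers_disjoint])
      also have "\<dots> = (\<Sum>x\<in>V 0. \<psi> i x * (\<Sum>k\<le>T. \<Sum>y\<in>V k. \<W> V E w 0 k x y * ?X k j y))"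
        by (simp add: \<psi>_layer_def sum_distrib_left sum_distrib_right mult.assoc sum.swap [of _ _ "V 0"])
      finally show ?thesis
        \<comment> \<open>The Kronecker delta is read backwards as the original pairing, which then
          splits into discounted part and losses.\<close>
        unfolding biorthogonal [symmetric]
        by (simp add: \<phi>_layer_0_eq [OF layers_disjoint, where q = q and w = w]
            distrib_left sum.distrib)
    qed
    then show ?thesis
      by (simp add: vec_eq_iff mat_def of_bool_def algebra_simps)
  qed
  also have "det \<dots> = Z_total V E ?g T \<psi> \<phi>"
    by (rule Z_total_eq_det [OF layers_disjoint, symmetric])
  finally have det_eq: "det (mat 1 - Q ** K_ext_matrix V E w T \<psi> \<phi>) = Z_total V E ?g T \<psi> \<phi>"
    by simp

  \<comment> \<open>Biorthogonality normalises the partition function to \<open>1\<close>, so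
    \<open>\<nu>\<close> coincides with \<open>Wt\<close>.\<close>
  have "Z_total V E w T \<psi> \<phi> = det (mat 1 :: real^'n^'n)"
    unfolding Z_total_eq_det [OF layers_disjoint] biorthogonal by (simp add: mat_def of_bool_def)
  then have "Z_total V E w T \<psi> \<phi> = 1" by simp
  then have "(\<Sum>\<P>\<in>non_intersecting V E T CARD('n).
      (\<Prod>\<pi>\<in>\<P>. \<Prod>n<T. 1 - q n (\<pi> n)) * \<nu> V E w T \<psi> \<phi> \<P>) = Z_total V E ?g T \<psi> \<phi>"
    unfolding Z_total_def [of V E ?g] \<nu>_def by (simp add: Wt_discounted [OF layers_disjoint])
  then show ?thesis
    using det_eq by (simp add: Q_def)
qed

end
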